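(* Let $q$ be a prime power, let $\kappa>0$, and let $f$ be a multiplicative function in the class $\mathcal{C}(\kappa)$. Let $n\ge 1$ be an integer, and let $$\mathcal{F}^\perp(z)=\exp\Big(\sum_{k=1}^{n-1}\frac{\chi(k)}{k}(qz)^k\Big)$$ (an entire function of $z\in\mathbb{C}$; equal to $1$ when $n=1$), and $\sigma^\perp(n)=\sigma(n)-\chi(n)/n$. Then $$|\sigma^\perp(n)|\le \frac{\kappa^2}{n}\int_0^1\Big(\max_{|z|=\sqrt t}|\mathcal{F}^\perp(z/q)|\Big)\Big(\frac{1-t^{n-1}}{1-t}\Big)\,dt,$$ and therefore $$|\sigma(n)|\le |\sigma^\perp(n)|+\Big|\frac{\chi(n)}{n}\Big|\le \frac{\kappa^2}{n}\int_0^1\Big(\max_{|z|=\sqrt t}|\mathcal{F}^\perp(z/q)|\Big)\Big(\frac{1-t^{n-1}}{1-t}\Big)\,dt+\frac{\kappa}{n}.$$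
   Context: Let $\mathcal{M}$ be the set of monic polynomials in $\mathbb{F}_q[x]$ and $\mathcal{M}_n$ those of degree $n$ (so $|\mathcal{M}_n|=q^n$). A function $f:\mathcal{M}\to\mathbb{C}$ is multiplicative if $f(FG)=f(F)f(G)$ whenever $F,G$ are coprime. Define $\Lambda(F)=\deg P$ if $F=P^k$ is a power ($k\ge1$) of a monic irreducible $P$, and $\Lambda(F)=0$ otherwise. For multiplicative $f$ with $f(1)=1$, define coefficients $\Lambda_f(F)$ (zero unless $F$ is a power of a monic irreducible) by the formal identity $\log\big(1+\sum_{k\ge1}f(P^k)z^{k\deg P}\big)=\sum_{k\ge1}\frac{\Lambda_f(P^k)}{k\deg P}z^{k\deg P}$ for each monic irreducible $P$; equivalently $z\mathcal{F}'(z)/\mathcal{F}(z)=\sum_{F\in\mathcal{M}}\Lambda_f(F)z^{\deg F}$ where $\mathcal{F}(z)=\sum_{F\in\mathcal{M}}f(F)z^{\deg F}$. The class $\mathcal{C}(\kappa)$ consists of multiplicative $f$ with $f(1)=1$ and $|\Lambda_f(F)|\le\kappa\Lambda(F)$ for all $F\in\mathcal{M}$. Define $\sigma(n)=q^{-n}\sum_{M\in\mathcal{M}_n}f(M)$ and $\chi(n)=q^{-n}\sum_{F\in\mathcal{M}_n}\Lambda_f(F)$. *)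

theory Defs
  imports
    "HOL-Analysis.Analysis"
    "HOL-Computational_Algebra.Computational_Algebra"
begin

text \<open>
  The field with \<open>q\<close> elements is an arbitrary finite field type \<open>'a\<close>, with \<open>q = CARD('a)\<close>.
  Arithmetic functions are total on \<open>'a poly\<close>; only their values on monic polynomials
  are ever used.
\<close>

definition monics :: "'a::field poly set" where
  "monics = {F. lead_coeff F = 1}"

definition monics_deg :: "nat \<Rightarrow> 'a::field poly set" where
  "monics_deg n = {F \<in> monics. degree F = n}"

definition monic_irreducible :: "'a::field poly \<Rightarrow> bool" where
  "monic_irreducible P \<longleftrightarrow> P \<in> monics \<and> irreducible P"

definition irreducible_power :: "'a::field poly \<Rightarrow> 'a poly \<Rightarrow> bool" where
  "irreducible_power P F \<longleftrightarrow> monic_irreducible P \<and> (\<exists>k\<ge>1. F = P ^ k)"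

definition irreducible_base :: "'a::field poly \<Rightarrow> 'a poly" where
  "irreducible_base F = (THE P. irreducible_power P F)"

definition mangoldt_poly :: "'a::field poly \<Rightarrow> nat" where
  "mangoldt_poly F =
     (if \<exists>P. irreducible_power P F then degree (irreducible_base F) else 0)"

definition multiplicative_on_monics :: "('a::field poly \<Rightarrow> complex) \<Rightarrow> bool" where
  "multiplicative_on_monics f \<longleftrightarrow>
     (\<forall>F\<in>monics. \<forall>G\<in>monics. coprime F G \<longrightarrow> f (F * G) = f F * f G)"

text \<open>The Euler factor at \<open>P\<close> without its constant term: \<open>\<Sum>k\<ge>1. f (P ^ k) z ^ (k deg P)\<close>.\<close>

definition euler_tail :: "('a::field poly \<Rightarrow> complex) \<Rightarrow> 'a poly \<Rightarrow> complex fps" where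
  "euler_tail f P = Abs_fps (\<lambda>m.
     if m \<ge> 1 \<and> degree P dvd m then f (P ^ (m div degree P)) else 0)"

text \<open>
  \<open>fps_ln 1\<close> is the series of \<open>log (1 + X)\<close>, so \<open>fps_ln 1 oo euler_tail f P\<close> is the formal
  logarithm of the Euler factor. The coefficients are read off from it: for \<open>F = P ^ k\<close>
  we have \<open>degree F = k deg P\<close>.
\<close>

definition mangoldt_of :: "('a::field poly \<Rightarrow> complex) \<Rightarrow> 'a poly \<Rightarrow> complex" where
  "mangoldt_of f F =
     (if \<exists>P. irreducible_power P F
      then of_nat (degree F) * fps_nth (fps_ln 1 oo euler_tail f (irreducible_base F)) (degree F)
      else 0)"

definition class_C :: "real \<Rightarrow> ('a::field poly \<Rightarrow> complex) set" where
  "class_C \<kappa> = {f. multiplicative_on_monics f \<and> f 1 = 1 \<and>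
     (\<forall>F\<in>monics. norm (mangoldt_of f F) \<le> \<kappa> * real (mangoldt_poly F))}"

definition sigma :: "('a::{field,finite} poly \<Rightarrow> complex) \<Rightarrow> nat \<Rightarrow> complex" where
  "sigma f n = (\<Sum>F\<in>monics_deg n. f F) / of_nat CARD('a) ^ n"

definition chi :: "('a::{field,finite} poly \<Rightarrow> complex) \<Rightarrow> nat \<Rightarrow> complex" where
  "chi f n = (\<Sum>F\<in>monics_deg n. mangoldt_of f F) / of_nat CARD('a) ^ n"

definition F_perp :: "('a::{field,finite} poly \<Rightarrow> complex) \<Rightarrow> nat \<Rightarrow> complex \<Rightarrow> complex" where
  "F_perp f n z = exp (\<Sum>k=1..n-1. chi f k / of_nat k * (of_nat CARD('a) * z) ^ k)"

definition sigma_perp :: "('a::{field,finite} poly \<Rightarrow> complex) \<Rightarrow> nat \<Rightarrow> complex" where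
  "sigma_perp f n = sigma f n - chi f n / of_nat n"

text \<open>
  \<open>max_F_perp f n t\<close> is the maximum of \<open>\<bar>F_perp f n (z / q)\<bar>\<close> over \<open>\<bar>z\<bar> = sqrt t\<close>; the supremum is
  attained, see \<open>max_F_perp_attained\<close>.
\<close>

definition max_F_perp :: "('a::{field,finite} poly \<Rightarrow> complex) \<Rightarrow> nat \<Rightarrow> real \<Rightarrow> real" where
  "max_F_perp f n t = (SUP z\<in>sphere 0 (sqrt t). norm (F_perp f n (z / of_nat CARD('a))))"

lemma F_perp_entire: "F_perp f n holomorphic_on UNIV"
  unfolding F_perp_def by (intro holomorphic_intros)

lemma F_perp_1: "F_perp f 1 z = 1"
  by (simp add: F_perp_def)

lemma max_F_perp_attained:
  fixes f :: "'a::{field,finite} poly \<Rightarrow> complex"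
  assumes "t \<ge> 0"
  obtains w where "norm w = sqrt t" "max_F_perp f n t = norm (F_perp f n (w / of_nat CARD('a)))"
    "\<And>z. norm z = sqrt t \<Longrightarrow> norm (F_perp f n (z / of_nat CARD('a))) \<le> max_F_perp f n t"
proof -
  let ?h = "\<lambda>z. norm (F_perp f n (z / of_nat CARD('a)))"
  have ne: "complex_of_real (sqrt t) \<in> sphere 0 (sqrt t)"
    using assms by simp
  have cont: "continuous_on (sphere 0 (sqrt t)) ?h"
    unfolding F_perp_def by (intro continuous_intros) auto
  obtain w where w: "w \<in> sphere 0 (sqrt t)" "\<And>z. z \<in> sphere 0 (sqrt t) \<Longrightarrow> ?h z \<le> ?h w"
    using continuous_attains_sup[OF compact_sphere _ cont] ne by blast
  have "max_F_perp f n t = ?h w"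
    unfolding max_F_perp_def by (rule cSup_eq_maximum) (use w in auto)
  with w show ?thesis by (intro that[of w]) auto
qed

lemma irreducible_power_unique:
  fixes P Q F :: "'a::field poly"
  assumes "irreducible_power P F" "irreducible_power Q F"
  shows "P = Q"
proof -
  obtain k l where k: "k \<ge> 1" "F = P ^ k" and l: "F = Q ^ l"
    and irr: "irreducible P" "irreducible Q" and lc: "lead_coeff P = 1" "lead_coeff Q = 1"
    using assms by (auto simp: irreducible_power_def monic_irreducible_def monics_def)
  have "P dvd Q ^ l"
    using k l dvd_power[of k P] by simp
  then have "P dvd Q"
    using field_poly_irreducible_imp_prime[OF irr(1)] prime_elem_dvd_power by blast
  then obtain c where c: "Q = P * c" by (auto elim: dvdE)
  then have "is_unit c"
    using irr irreducibleD irreducible_not_unit by blast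
  then obtain a where "c = [:a:]" by (auto simp: is_unit_poly_iff)
  with c have Q: "Q = smult a P" by simp
  with lc have "a = 1" by (simp del: coeff_smult degree_smult_eq add: lead_coeff_smult)
  with Q show ?thesis by simp
qed

lemma irreducible_base_eq: "irreducible_power P F \<Longrightarrow> irreducible_base F = P"
  unfolding irreducible_base_def using irreducible_power_unique by blast

lemma euler_tail_power_nth_eq_0:
  "\<not> degree P dvd m \<Longrightarrow> fps_nth (euler_tail f P ^ i) m = 0"
proof (induction i arbitrary: m)
  case 0
  then show ?case by (cases "m = 0") auto
next
  case (Suc i)
  have "fps_nth (euler_tail f P) j * fps_nth (euler_tail f P ^ i) (m - j) = 0" if "j \<le> m" for j
  proof (cases "degree P dvd j")
    case True
    then have "\<not> degree P dvd (m - j)"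
      using Suc.prems that by (metis dvd_diffD)
    then show ?thesis using Suc.IH by simp
  qed (simp add: euler_tail_def)
  then show ?case by (auto simp: fps_mult_nth intro!: sum.neutral)
qed

text \<open>The formal identity defining the coefficients \<open>mangoldt_of f (P ^ k)\<close>.\<close>

lemma mangoldt_of_log_identity:
  assumes P: "monic_irreducible P"
  shows "fps_ln 1 oo euler_tail f P = Abs_fps (\<lambda>m.
    if m \<ge> 1 \<and> degree P dvd m then mangoldt_of f (P ^ (m div degree P)) / of_nat m else 0)"
proof (rule fps_ext)
  fix m
  show "fps_nth (fps_ln 1 oo euler_tail f P) m = fps_nth (Abs_fps (\<lambda>m.
    if m \<ge> 1 \<and> degree P dvd m then mangoldt_of f (P ^ (m div degree P)) / of_nat m else 0)) m"
  proof (cases "m \<ge> 1 \<and> degree P dvd m")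
    case True
    then obtain k where k: "m = degree P * k" by (auto elim: dvdE)
    with True have pos: "k \<ge> 1" "degree P > 0" by (auto intro: Suc_leI gr0I)
    then have pow: "irreducible_power P (P ^ k)"
      using P by (auto simp: irreducible_power_def)
    have "degree (P ^ k) = m"
      using P k by (simp add: monic_irreducible_def degree_power_eq mult.commute irreducible_def)
    then have "mangoldt_of f (P ^ k) = of_nat m * fps_nth (fps_ln 1 oo euler_tail f P) m"
      using pow irreducible_base_eq[OF pow] by (auto simp: mangoldt_of_def)
    moreover have "m div degree P = k"
      using k pos by simp
    ultimately show ?thesis using True by simp
  next
    case False
    then show ?thesis
    proof (cases "m = 0")
      case False
      with \<open>\<not> (m \<ge> 1 \<and> degree P dvd m)\<close> show ?thesis
        by (auto simp: fps_compose_nth euler_tail_power_nth_eq_0)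
    qed simp
  qed
qed

lemma mangoldt_poly_power:
  assumes "monic_irreducible P" "k \<ge> 1"
  shows "mangoldt_poly (P ^ k) = degree P"
proof -
  have pow: "irreducible_power P (P ^ k)"
    using assms by (auto simp: irreducible_power_def)
  then show ?thesis
    using irreducible_base_eq[OF pow] by (auto simp: mangoldt_poly_def)
qed

end

theory Submission
  imports Defs "HOL-Complex_Analysis.Complex_Analysis"
begin

text \<open>
  Writing \<open>F_perp(z / q) = G(z)\<close>, logarithmic differentiation of the generating functions gives
  \<open>n \<sigma>(n) = \<Sum>k. \<chi>(k) \<sigma>(n - k)\<close>, hence \<open>n \<sigma>_perp(n) = \<Sum>k<n. \<chi>(k) \<sigma>(n - k)\<close>; moreover the
  coefficients of \<open>G\<close> below \<open>n\<close> are the \<open>\<sigma>(m)\<close>. Inserting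
  \<open>1 = (n - k) \<integral> t ^ (n - k - 1) dt\<close> and \<open>m \<sigma>(m) = \<Sum>j. \<chi>(j) \<sigma>(m - j)\<close> turns
  \<open>n \<sigma>_perp(n)\<close> into the integral over \<open>t\<close> of the coefficient of \<open>z ^ n\<close> in a product
  \<open>A(z) B(z) G(z)\<close> with two polynomials \<open>A\<close>, \<open>B\<close>. Cauchy's formula on \<open>\<bar>z\<bar> = sqrt t\<close>, Parseval's
  identity for \<open>A\<close> and \<open>B\<close>, and \<open>\<bar>\<chi>(k)\<bar> \<le> \<kappa>\<close> (from the prime polynomial theorem
  \<open>\<Sum>F. \<Lambda>(F) = q ^ k\<close> over monic \<open>F\<close> of degree \<open>k\<close>) bound that coefficient by the integrand.
  The integrand is nondecreasing on \<open>[0, 1)\<close> by the maximum modulus principle, hence integrable.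
\<close>

unbundle no vec_syntax

section \<open>Monic polynomials and irreducible powers\<close>

lemma monics_deg_0: "monics_deg 0 = {1 :: 'a::field poly}"
  by (auto simp: monics_deg_def monics_def elim!: degree_eq_zeroE)

text \<open>The constant coefficient is free and the remaining ones form a monic polynomial of
  degree \<open>n\<close>; induction on this gives finiteness and the count
  \<open>q ^ n\<close>.\<close>

lemma monics_deg_Suc:
  "monics_deg (Suc n) = (\<lambda>(a, F). pCons a F) ` (UNIV \<times> monics_deg n :: ('a::field \<times> 'a poly) set)"
proof (intro subset_antisym subsetI)
  fix F :: "'a poly"
  assume F: "F \<in> monics_deg (Suc n)"
  obtain a G where FG: "F = pCons a G" by (cases F)
  with F have "G \<noteq> 0" by (auto simp: monics_deg_def)
  with F FG have "G \<in> monics_deg n" by (auto simp: monics_deg_def monics_def)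
  with FG show "F \<in> (\<lambda>(a, F). pCons a F) ` (UNIV \<times> monics_deg n)" by auto
next
  fix F :: "'a poly"
  assume "F \<in> (\<lambda>(a, F). pCons a F) ` (UNIV \<times> monics_deg n)"
  then obtain a G where FG: "F = pCons a G" and G: "G \<in> monics_deg n" by auto
  from G have "G \<noteq> 0" by (auto simp: monics_deg_def monics_def)
  with G FG show "F \<in> monics_deg (Suc n)" by (auto simp: monics_deg_def monics_def)
qed

lemma finite_monics_deg [simp]: "finite (monics_deg n :: 'a::{field,finite} poly set)"
  by (induction n) (auto simp: monics_deg_0 monics_deg_Suc)

lemma card_monics_deg: "card (monics_deg n :: 'a::{field,finite} poly set) = CARD('a) ^ n"
proof (induction n)
  case (Suc n)
  have "inj_on (\<lambda>(a, F). pCons a F) (UNIV \<times> monics_deg n :: ('a \<times> 'a poly) set)"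
    by (auto simp: inj_on_def)
  with Suc show ?case by (simp add: monics_deg_Suc card_image card_cartesian_product)
qed (simp add: monics_deg_0)

lemma monics_nonzero: "F \<in> monics \<Longrightarrow> F \<noteq> 0"
  by (auto simp: monics_def)

lemma monics_mult_iff:
  assumes "F \<in> monics" shows "F * G \<in> monics \<longleftrightarrow> G \<in> monics"
  using assms by (simp add: monics_def lead_coeff_mult)

lemma monics_power: "F \<in> monics \<Longrightarrow> F ^ k \<in> monics"
  by (simp add: monics_def lead_coeff_power)

section \<open>Divisibility by monic irreducibles\<close>

lemma monic_irreducible_degree_pos:
  assumes "monic_irreducible P" shows "degree P > 0"
proof (rule gr0I)
  assume "degree P = 0"
  with assms have "P = 1" by (auto simp: monic_irreducible_def monics_def elim!: degree_eq_zeroE)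
  with assms show False by (simp add: monic_irreducible_def irreducible_def)
qed

lemma irreducible_power_degree_pos:
  assumes "irreducible_power P F" shows "degree F > 0"
  using assms monic_irreducible_degree_pos[of P] monics_nonzero[of P]
  by (auto simp: irreducible_power_def monic_irreducible_def degree_power_eq)

lemma irreducible_power_monics: "irreducible_power P F \<Longrightarrow> F \<in> monics"
  by (auto simp: irreducible_power_def monic_irreducible_def intro: monics_power)

lemma monic_irreducible_prime_elem: "monic_irreducible P \<Longrightarrow> prime_elem P"
  by (auto simp: monic_irreducible_def intro: field_poly_irreducible_imp_prime)

lemma monic_multiple:
  assumes "F \<noteq> (0 :: 'a::field poly)"
  obtains c where "c \<noteq> 0" "smult c F \<in> monics"
  using assms by (intro that[of "inverse (lead_coeff F)"]) (auto simp: monics_def lead_coeff_smult)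

text \<open>A nonconstant divisor of least degree is irreducible.\<close>

lemma monic_irreducible_divisor_exists:
  assumes "degree F > 0"
  obtains P where "monic_irreducible P" "P dvd F"
proof -
  define D where "D G \<longleftrightarrow> degree G > 0 \<and> G dvd F" for G
  have "D F" using assms by (simp add: D_def)
  then obtain G where G: "D G" and min: "\<And>H. D H \<Longrightarrow> degree G \<le> degree H"
    by (metis ex_least_nat_le arg_min_natI arg_min_nat_le)
  then have "G \<noteq> 0" by (auto simp: D_def)
  then obtain c where c: "c \<noteq> 0" "smult c G \<in> monics" by (rule monic_multiple)
  have "irreducible (smult c G)"
  proof (rule irreducibleI)
    show "smult c G \<noteq> 0" using c \<open>G \<noteq> 0\<close> by simp
    show "\<not> is_unit (smult c G)" using c G by (auto simp: is_unit_iff_degree \<open>G \<noteq> 0\<close> D_def)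
    fix a b assume ab: "smult c G = a * b"
    then have nz: "a \<noteq> 0" "b \<noteq> 0" using c \<open>G \<noteq> 0\<close> by auto
    have deg: "degree G = degree a + degree b"
      using c degree_mult_eq[OF nz] ab by (metis degree_smult_eq)
    have "smult c G dvd F" using c G by (simp add: smult_dvd_iff D_def)
    then have "a dvd F" unfolding ab by (rule dvd_mult_left)
    show "is_unit a \<or> is_unit b"
    proof (cases "degree a = 0")
      case False
      with \<open>a dvd F\<close> have "degree G \<le> degree a" by (intro min) (simp add: D_def)
      with deg nz show ?thesis by (simp add: is_unit_iff_degree)
    qed (simp add: is_unit_iff_degree nz)
  qed
  with c G show ?thesis
    by (intro that[of "smult c G"]) (auto simp: monic_irreducible_def smult_dvd_iff D_def)
qed

text \<open>Factors \<open>P\<close> are stripped off one at a time, each lowering the degree. The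
  cofactor is monic because \<open>F\<close> and \<open>P ^ a\<close> are.\<close>

lemma monic_divide_power:
  assumes P: "monic_irreducible P" and F: "F \<in> monics"
  obtains a M where "F = P ^ a * M" "\<not> P dvd M" "M \<in> monics"
proof -
  have "\<exists>a M. F = P ^ a * M \<and> \<not> P dvd M" using monics_nonzero[OF F]
  proof (induction "degree F" arbitrary: F rule: less_induct)
    case less
    show ?case
    proof (cases "P dvd F")
      case True
      then obtain G where G: "F = P * G" by (elim dvdE)
      with less.prems have "G \<noteq> 0" "degree G < degree F"
        using monic_irreducible_degree_pos[OF P] by (auto simp: degree_mult_eq)
      then obtain a M where "G = P ^ a * M" "\<not> P dvd M" using less.hyps by blast
      with G show ?thesis by (intro exI[of _ "Suc a"] exI[of _ M]) (auto simp: mult_ac)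
    qed (intro exI[of _ 0] exI[of _ F]; simp)
  qed
  then obtain a M where aM: "F = P ^ a * M" "\<not> P dvd M" by blast
  moreover from P have "P ^ a \<in> monics" by (simp add: monic_irreducible_def monics_power)
  ultimately show ?thesis using F that monics_mult_iff by blast
qed

text \<open>A common divisor \<open>c\<close> is not divisible by \<open>P\<close>, so in
  \<open>P * P ^ a = c * e\<close> primality puts the factor \<open>P\<close> into \<open>e\<close>;
  cancelling it lowers the exponent until \<open>c\<close> divides 1.\<close>

lemma coprime_irreducible_power:
  fixes P M :: "'a::field poly"
  assumes "irreducible P" and "\<not> P dvd M"
  shows "coprime (P ^ a) M"
proof (rule coprimeI)
  fix c assume "c dvd P ^ a" and cM: "c dvd M"
  have "prime_elem P" using assms(1) by (rule field_poly_irreducible_imp_prime)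
  have nd: "\<not> P dvd c" using cM assms(2) dvd_trans by blast
  from \<open>c dvd P ^ a\<close> show "is_unit c"
  proof (induction a)
    case (Suc a)
    then obtain e where e: "P * P ^ a = c * e" by (auto elim: dvdE)
    then have "P dvd c * e" by (metis dvd_triv_left)
    with \<open>prime_elem P\<close> nd have "P dvd e" using prime_elem_dvd_multD by blast
    then obtain e' where "e = P * e'" by (elim dvdE)
    with e have "P * P ^ a = P * (c * e')" by (simp add: mult_ac)
    with assms(1) have "P ^ a = c * e'" by (auto simp: irreducible_def)
    then show ?case using Suc.IH by simp
  qed simp
qed

text \<open>Since \<open>1 + k = Suc k\<close>, divisibility of \<open>A * M\<close> by
  \<open>Q ^ k\<close> forces \<open>Q ^ 1\<close> to divide \<open>A\<close> or
  \<open>Q ^ k\<close> to divide \<open>M\<close>.\<close>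

lemma prime_elem_power_dvd_mult_cancel:
  fixes Q :: "'a::algebraic_semidom"
  assumes "prime_elem Q" "\<not> Q dvd A" "Q ^ k dvd A * M"
  shows "Q ^ k dvd M"
  using prime_elem_power_dvd_cases[of Q k A M 1 k] assms by auto

lemma monic_irreducible_dvd_eq:
  assumes "monic_irreducible P" "monic_irreducible Q" "Q dvd P ^ a"
  shows "Q = P"
proof (cases a)
  case 0
  with assms show ?thesis by (simp add: monic_irreducible_def irreducible_def)
next
  case (Suc b)
  have "Q dvd P"
    using assms monic_irreducible_prime_elem prime_elem_dvd_power by blast
  then obtain c where c: "P = Q * c" by (elim dvdE)
  then have "is_unit c"
    using assms irreducibleD irreducible_not_unit unfolding monic_irreducible_def by blast
  moreover have "c \<in> monics"
    using assms c monics_mult_iff unfolding monic_irreducible_def by blast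
  ultimately have "c = 1"
    by (auto simp: is_unit_poly_iff monics_def)
  with c show ?thesis by simp
qed

section \<open>Divisors that are powers of irreducibles\<close>

lemma finite_monic_divisors:
  assumes "F \<noteq> (0 :: 'a::{field,finite} poly)"
  shows "finite {G \<in> monics. G dvd F}"
proof (rule finite_subset)
  show "{G \<in> monics. G dvd F} \<subseteq> (\<Union>k\<le>degree F. monics_deg k)"
    using assms by (auto simp: monics_deg_def dvd_imp_degree_le)
qed auto

text \<open>These are the only divisors at which a von Mangoldt function can be nonzero, so they
  index the divisor sums below.\<close>

definition irreducible_power_divisors :: "'a::field poly \<Rightarrow> 'a poly set" where
  "irreducible_power_divisors F = {G. (\<exists>P. irreducible_power P G) \<and> G dvd F}"

text \<open>If \<open>Q ^ k\<close> divides the product, then either \<open>Q\<close> divides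
  \<open>P ^ a\<close>, so \<open>Q = P\<close> and \<open>k \<le> a\<close> because
  \<open>P\<close> does not divide \<open>M\<close>, or it does not, and then \<open>Q ^ k\<close>
  divides \<open>M\<close>. The two sets are disjoint because a common element would make
  \<open>P\<close> divide \<open>M\<close>.\<close>

lemma irreducible_power_divisors_split:
  assumes P: "monic_irreducible P" and M: "\<not> P dvd M"
  shows "irreducible_power_divisors (P ^ a * M) = (\<lambda>j. P ^ j) ` {1..a} \<union> irreducible_power_divisors M"
    and "(\<lambda>j. P ^ j) ` {1..a} \<inter> irreducible_power_divisors M = {}"
proof -
  have nz: "P \<noteq> 0" using P by (auto simp: monic_irreducible_def irreducible_def)
  show "irreducible_power_divisors (P ^ a * M) = (\<lambda>j. P ^ j) ` {1..a} \<union> irreducible_power_divisors M"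
  proof (intro subset_antisym subsetI)
    fix G assume "G \<in> irreducible_power_divisors (P ^ a * M)"
    then obtain Q k where Q: "monic_irreducible Q" "k \<ge> 1" "G = Q ^ k" "Q ^ k dvd P ^ a * M"
      by (auto simp: irreducible_power_divisors_def irreducible_power_def)
    show "G \<in> (\<lambda>j. P ^ j) ` {1..a} \<union> irreducible_power_divisors M"
    proof (cases "Q dvd P ^ a")
      case True
      then have "Q = P" using P Q monic_irreducible_dvd_eq by blast
      have "k \<le> a"
      proof (rule ccontr)
        assume "\<not> k \<le> a"
        then have "P ^ a * P dvd P ^ k"
          by (metis le_imp_power_dvd not_less_eq_eq power_Suc2)
        then have "P ^ a * P dvd P ^ a * M"
          using Q \<open>Q = P\<close> dvd_trans by blast
        with nz M show False by simp
      qed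
      with Q \<open>Q = P\<close> show ?thesis by auto
    next
      case False
      then have "Q ^ k dvd M"
        using Q monic_irreducible_prime_elem prime_elem_power_dvd_mult_cancel by blast
      with Q show ?thesis
        by (auto simp: irreducible_power_divisors_def irreducible_power_def)
    qed
  next
    fix G assume "G \<in> (\<lambda>j. P ^ j) ` {1..a} \<union> irreducible_power_divisors M"
    then show "G \<in> irreducible_power_divisors (P ^ a * M)"
      using P unfolding irreducible_power_divisors_def irreducible_power_def
      by (fastforce intro: dvd_mult2 le_imp_power_dvd)
  qed
  have "P dvd M" if "j \<ge> 1" "P ^ j dvd M" for j
    using that dvd_power[of j P] dvd_trans by auto
  with M show "(\<lambda>j. P ^ j) ` {1..a} \<inter> irreducible_power_divisors M = {}"
    by (auto simp: irreducible_power_divisors_def)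
qed

lemma finite_irreducible_power_divisors:
  assumes "F \<noteq> (0 :: 'a::{field,finite} poly)"
  shows "finite (irreducible_power_divisors F)"
  by (rule finite_subset[OF _ finite_monic_divisors[OF assms]])
     (auto simp: irreducible_power_divisors_def intro: irreducible_power_monics)

section \<open>The convolution identity and the prime polynomial theorem\<close>

text \<open>As in the product rule, the degree is additive and \<open>f\<close> multiplicative over
  \<open>F = P ^ a * M\<close>: by the hypothesis on \<open>L\<close> the powers of \<open>P\<close>
  contribute \<open>a * degree P * f F\<close>, and by induction the divisors of \<open>M\<close>
  contribute \<open>degree M * f F\<close>. \<open>L\<close> is left abstract so that it can be
  \<open>mangoldt_of f\<close> and, with \<open>f = 1\<close>, also
  \<open>mangoldt_poly\<close>.\<close>

lemma mangoldt_convolution_monic: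
  fixes f L :: "'a::{field,finite} poly \<Rightarrow> complex"
  assumes mult: "multiplicative_on_monics f"
    and L: "\<And>P k. monic_irreducible P \<Longrightarrow>
      of_nat (k * degree P) * f (P ^ k) = (\<Sum>j=1..k. L (P ^ j) * f (P ^ (k - j)))"
    and "F \<in> monics"
  shows "of_nat (degree F) * f F = (\<Sum>G\<in>irreducible_power_divisors F. L G * f (F div G))"
  using \<open>F \<in> monics\<close>
proof (induction "degree F" arbitrary: F rule: less_induct)
  case less
  show ?case
  proof (cases "degree F = 0")
    case True
    have "F \<noteq> 0" using less.prems by (rule monics_nonzero)
    have "G \<notin> irreducible_power_divisors F" for G
      using dvd_imp_degree_le[of G F] \<open>F \<noteq> 0\<close> True irreducible_power_degree_pos
      by (fastforce simp: irreducible_power_divisors_def)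
    then have "irreducible_power_divisors F = {}" by blast
    with True show ?thesis by simp
  next
    case False
    then obtain P where P: "monic_irreducible P" "P dvd F"
      using monic_irreducible_divisor_exists by blast
    obtain a M where F: "F = P ^ a * M" and M: "\<not> P dvd M" "M \<in> monics"
      using P(1) less.prems by (rule monic_divide_power)
    with P have "a > 0" by (cases a) auto
    have nz: "P \<noteq> 0" "M \<noteq> 0" using P M monics_nonzero by (auto simp: monic_irreducible_def)
    have Pm: "P ^ k \<in> monics" for k using P by (simp add: monic_irreducible_def monics_power)
    have degF: "degree F = a * degree P + degree M"
      using nz by (simp add: F degree_mult_eq degree_power_eq)
    have "degree M < degree F"
      using degF \<open>a > 0\<close> monic_irreducible_degree_pos[OF P(1)] by simp
    then have IH: "of_nat (degree M) * f M = (\<Sum>G\<in>irreducible_power_divisors M. L G * f (M div G))"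
      using less.hyps M by blast
    have split: "f (P ^ k * N) = f (P ^ k) * f N" if "\<not> P dvd N" "N \<in> monics" for k N
      using mult Pm[of k] that coprime_irreducible_power[of P N k] P(1)
      unfolding multiplicative_on_monics_def monic_irreducible_def by blast
    have P_powers: "(\<Sum>G\<in>(\<lambda>j. P ^ j) ` {1..a}. L G * f (F div G)) = of_nat (a * degree P) * f F"
    proof -
      have inj: "inj_on (\<lambda>j. P ^ j) {1..a}"
      proof (rule inj_onI)
        fix i j assume "P ^ i = P ^ j"
        then have "degree (P ^ i) = degree (P ^ j)" by simp
        then show "i = j" using monic_irreducible_degree_pos[OF P(1)] nz by (simp add: degree_power_eq)
      qed
      have "F div P ^ j = P ^ (a - j) * M" if "j \<le> a" for j
      proof -
        have "F = P ^ j * (P ^ (a - j) * M)"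
          unfolding F using that by (simp flip: power_add mult.assoc)
        then show ?thesis using nz by simp
      qed
      then have "(\<Sum>G\<in>(\<lambda>j. P ^ j) ` {1..a}. L G * f (F div G))
          = (\<Sum>j=1..a. L (P ^ j) * f (P ^ (a - j)) * f M)"
        unfolding sum.reindex[OF inj] o_def
        by (intro sum.cong) (simp_all add: split M)
      also have "\<dots> = of_nat (a * degree P) * f (P ^ a) * f M"
        by (simp only: L[OF P(1)] sum_distrib_right)
      finally show ?thesis by (simp add: F split M)
    qed
    have M_powers: "(\<Sum>G\<in>irreducible_power_divisors M. L G * f (F div G)) = of_nat (degree M) * f F"
    proof -
      have "f (F div G) = f (P ^ a) * f (M div G)" if G: "G \<in> irreducible_power_divisors M" for G
      proof -
        from G obtain N where N: "M = G * N" by (auto simp: irreducible_power_divisors_def elim: dvdE)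
        have "G \<in> monics" using G irreducible_power_monics by (auto simp: irreducible_power_divisors_def)
        then have "G \<noteq> 0" "N \<in> monics" using M monics_mult_iff monics_nonzero unfolding N by auto
        moreover have "\<not> P dvd N" using M by (auto simp: N)
        moreover have "F = G * (P ^ a * N)" by (simp add: F N mult_ac)
        ultimately show ?thesis by (simp add: N split)
      qed
      then have "(\<Sum>G\<in>irreducible_power_divisors M. L G * f (F div G))
          = f (P ^ a) * (\<Sum>G\<in>irreducible_power_divisors M. L G * f (M div G))"
        by (simp add: sum_distrib_left mult_ac)
      then show ?thesis by (simp add: IH[symmetric] F split M)
    qed
    note split_div = irreducible_power_divisors_split[OF P(1) M(1), of a]
    show ?thesis unfolding split_div(1)[folded F]
      by (subst sum.union_disjoint)
         (use nz split_div(2) P_powers M_powers degF in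
           \<open>auto simp: finite_irreducible_power_divisors algebra_simps\<close>)
  qed
qed

text \<open>The pointwise identity is summed over \<open>F\<close>, and the pairs
  \<open>(F, G)\<close> become pairs \<open>(G, F div G)\<close>, grouped by the degree of
  \<open>G\<close>. This is the coefficient form of the logarithmic derivative of the generating
  function.\<close>

lemma mangoldt_convolution:
  fixes f L :: "'a::{field,finite} poly \<Rightarrow> complex"
  assumes mult: "multiplicative_on_monics f"
    and L0: "\<And>F. \<nexists>P. irreducible_power P F \<Longrightarrow> L F = 0"
    and L: "\<And>P k. monic_irreducible P \<Longrightarrow>
      of_nat (k * degree P) * f (P ^ k) = (\<Sum>j=1..k. L (P ^ j) * f (P ^ (k - j)))"
  shows "of_nat n * (\<Sum>F\<in>monics_deg n. f F)
    = (\<Sum>k=1..n. (\<Sum>G\<in>monics_deg k. L G) * (\<Sum>D\<in>monics_deg (n - k). f D))"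
proof -
  \<comment> \<open>The bound on the degree of \<open>G\<close> matters: for larger degrees the
    truncated \<open>n - degree G\<close> would be 0 and admit \<open>D = 1\<close>.\<close>
  define I where "I = {G \<in> (\<Union>k\<in>{1..n}. monics_deg k). \<exists>P :: 'a poly. irreducible_power P G}"
  have "of_nat n * (\<Sum>F\<in>monics_deg n. f F) = (\<Sum>F\<in>monics_deg n. of_nat (degree F) * f F)"
    by (simp add: sum_distrib_left monics_deg_def)
  also have "\<dots> = (\<Sum>F\<in>monics_deg n. \<Sum>G\<in>irreducible_power_divisors F. L G * f (F div G))"
    by (intro sum.cong refl mangoldt_convolution_monic assms) (auto simp: monics_deg_def)
  also have "\<dots> = (\<Sum>(F, G)\<in>(SIGMA F:monics_deg n. irreducible_power_divisors F). L G * f (F div G))"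
    by (intro sum.Sigma) (simp, auto simp: monics_deg_def dest: monics_nonzero intro!: finite_irreducible_power_divisors)
  also have "\<dots> = (\<Sum>(G, D)\<in>(SIGMA G:I. monics_deg (n - degree G)). L G * f D)"
  proof (rule sum.reindex_bij_witness[where i = "\<lambda>(G, D). (G * D, G)" and j = "\<lambda>(F, G). (G, F div G)"])
    fix x :: "'a poly \<times> 'a poly" assume "x \<in> (SIGMA F:monics_deg n :: 'a poly set. irreducible_power_divisors F)"
    then obtain F G P where x: "x = (F, G)" and F: "F \<in> monics" "degree F = n"
      and G: "irreducible_power P G" "G dvd F"
      by (auto simp: irreducible_power_divisors_def monics_deg_def)
    obtain D where D: "F = G * D" using G by (elim dvdE)
    have Gm: "G \<in> monics" using G irreducible_power_monics by blast
    then have Dm: "D \<in> monics" using F monics_mult_iff unfolding D by blast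
    have nz: "G \<noteq> 0" "D \<noteq> 0" using Gm Dm monics_nonzero by auto
    show "(case case x of (F, G) \<Rightarrow> (G, F div G) of (G, D) \<Rightarrow> (G * D, G)) = x"
      using nz by (simp add: x D)
    show "(case x of (F, G) \<Rightarrow> (G, F div G)) \<in> (SIGMA G:I. monics_deg (n - degree G))"
      using nz Gm Dm F G irreducible_power_degree_pos[OF G(1)]
      by (auto simp: x D I_def monics_deg_def degree_mult_eq)
    show "(case case x of (F, G) \<Rightarrow> (G, F div G) of (G, D) \<Rightarrow> L G * f D)
        = (case x of (F, G) \<Rightarrow> L G * f (F div G))"
      by (simp add: x)
  next
    fix y :: "'a poly \<times> 'a poly" assume "y \<in> (SIGMA G:I. monics_deg (n - degree G))"
    then obtain G D P where y: "y = (G, D)" and G: "G \<in> monics" "degree G \<le> n" "irreducible_power P G"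
      and D: "D \<in> monics" "degree D = n - degree G"
      by (auto simp: I_def monics_deg_def)
    have nz: "G \<noteq> 0" "D \<noteq> 0" using G D monics_nonzero by auto
    show "(case case y of (G, D) \<Rightarrow> (G * D, G) of (F, G) \<Rightarrow> (G, F div G)) = y"
      using nz by (simp add: y)
    show "(case y of (G, D) \<Rightarrow> (G * D, G)) \<in> (SIGMA F:monics_deg n. irreducible_power_divisors F)"
      using nz G D by (auto simp: y monics_deg_def irreducible_power_divisors_def monics_mult_iff degree_mult_eq)
  qed
  also have "\<dots> = (\<Sum>G\<in>I. L G * (\<Sum>D\<in>monics_deg (n - degree G). f D))"
    by (subst sum.Sigma[symmetric]) (auto simp: I_def sum_distrib_left)
  also have "\<dots> = (\<Sum>G\<in>(\<Union>k\<in>{1..n}. monics_deg k). L G * (\<Sum>D\<in>monics_deg (n - degree G). f D))"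
    by (rule sum.mono_neutral_left) (use L0 in \<open>auto simp: I_def\<close>)
  also have "\<dots> = (\<Sum>k=1..n. \<Sum>G\<in>monics_deg k. L G * (\<Sum>D\<in>monics_deg (n - degree G). f D))"
    by (rule sum.UNION_disjoint) (auto simp: monics_deg_def finite_monics_deg[unfolded monics_deg_def])
  also have "\<dots> = (\<Sum>k=1..n. (\<Sum>G\<in>monics_deg k. L G) * (\<Sum>D\<in>monics_deg (n - k). f D))"
    by (intro sum.cong refl) (auto simp: sum_distrib_right monics_deg_def)
  finally show ?thesis .
qed

text \<open>With \<open>f = 1\<close> the convolution reads
  \<open>n * q ^ n = (\<Sum>k=1..n. S k * q ^ (n - k))\<close>; subtracting \<open>q\<close> times
  the same identity for \<open>n - 1\<close> leaves
  \<open>S n = n * q ^ n - (n - 1) * q ^ n\<close>.\<close>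

lemma sum_mangoldt_poly:
  assumes "n \<ge> 1"
  shows "(\<Sum>F\<in>monics_deg n. mangoldt_poly (F :: 'a::{field,finite} poly)) = CARD('a) ^ n"
proof -
  let ?q = "of_nat CARD('a) :: complex"
  let ?S = "\<lambda>k. \<Sum>G\<in>monics_deg k. of_nat (mangoldt_poly (G :: 'a poly)) :: complex"
  have conv: "of_nat n * ?q ^ n = (\<Sum>k=1..n. ?S k * ?q ^ (n - k))" for n
  proof -
    have "of_nat n * (\<Sum>F\<in>monics_deg n. (\<lambda>_ :: 'a poly. 1 :: complex) F)
      = (\<Sum>k=1..n. ?S k * (\<Sum>D\<in>monics_deg (n - k). (\<lambda>_ :: 'a poly. 1 :: complex) D))"
    proof (rule mangoldt_convolution)
      show "(of_nat (mangoldt_poly F) :: complex) = 0" if "\<nexists>P. irreducible_power P F" for F :: "'a poly"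
        using that by (simp add: mangoldt_poly_def)
    qed (auto simp: multiplicative_on_monics_def mangoldt_poly_power)
    then show ?thesis by (simp add: card_monics_deg)
  qed
  obtain m where n: "n = Suc m" using assms by (cases n) auto
  have "(\<Sum>k=1..m. ?S k * ?q ^ (n - k)) = ?q * (\<Sum>k=1..m. ?S k * ?q ^ (m - k))"
    unfolding sum_distrib_left by (intro sum.cong) (auto simp: n Suc_diff_le mult_ac)
  also have "\<dots> = of_nat m * ?q ^ n"
    by (simp only: conv[of m, symmetric]) (simp add: n)
  finally have "?S n = ?q ^ n"
    using conv[of n] by (simp add: n algebra_simps)
  then have "of_nat (\<Sum>F\<in>monics_deg n. mangoldt_poly (F :: 'a poly)) = (of_nat (CARD('a) ^ n) :: complex)"
    by simp
  then show ?thesis by (simp only: of_nat_eq_iff)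
qed

text \<open>The formal logarithm \<open>L\<close> of \<open>1 + T\<close>, with \<open>T\<close> the
  Euler tail, satisfies \<open>L' * (1 + T) = T'\<close>. After multiplication by
  \<open>fps_X\<close>, the coefficients at \<open>k * degree P\<close> are the two sides.\<close>

lemma mangoldt_of_recurrence:
  assumes P: "monic_irreducible P" and f1: "f 1 = 1"
  shows "of_nat (k * degree P) * f (P ^ k) = (\<Sum>j=1..k. mangoldt_of f (P ^ j) * f (P ^ (k - j)))"
proof (cases "k = 0")
  case False
  define d where "d = degree P"
  have d: "d > 0" unfolding d_def by (rule monic_irreducible_degree_pos[OF P])
  let ?T = "euler_tail f P"
  let ?L = "fps_ln 1 oo ?T"
  have T0: "?T $ 0 = 0" by (simp add: euler_tail_def)
  have "fps_deriv ?L * (1 + ?T) = fps_deriv ?T"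
  proof -
    have "(inverse (1 + fps_X) oo ?T) * (1 + ?T) = 1"
    proof -
      have "(inverse (1 + fps_X) oo ?T) * ((1 + fps_X) oo ?T) = (inverse (1 + fps_X) * (1 + fps_X)) oo ?T"
        by (rule fps_compose_mult_distrib[symmetric]) (rule T0)
      also have "inverse (1 + fps_X) * (1 + fps_X) = (1 :: complex fps)"
        by (rule inverse_mult_eq_1) simp
      finally show ?thesis by (simp add: fps_compose_add_distrib T0)
    qed
    then show ?thesis by (simp add: fps_compose_deriv[OF T0] fps_ln_deriv mult_ac)
  qed
  then have "(fps_X * fps_deriv ?L) * (1 + ?T) = fps_X * fps_deriv ?T"
    by (simp add: mult_ac)
  then have "(\<Sum>i=0..k*d. (fps_X * fps_deriv ?L) $ i * (1 + ?T) $ (k * d - i)) = (fps_X * fps_deriv ?T) $ (k * d)"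
    by (simp only: fps_mult_nth[symmetric])
  also have "(fps_X * fps_deriv ?T) $ (k * d) = of_nat (k * d) * f (P ^ k)"
    using False d by (auto simp: euler_tail_def d_def)
  \<comment> \<open>The logarithm has terms only at multiples of \<open>d\<close>, and index 0 drops
    out because of the factor \<open>fps_X\<close>.\<close>
  also have "(\<Sum>i=0..k*d. (fps_X * fps_deriv ?L) $ i * (1 + ?T) $ (k * d - i))
    = (\<Sum>i\<in>(\<lambda>j. j * d) ` {1..k}. (fps_X * fps_deriv ?L) $ i * (1 + ?T) $ (k * d - i))"
  proof (rule sum.mono_neutral_right; (intro ballI)?)
    fix i assume i: "i \<in> {0..k*d} - (\<lambda>j. j * d) ` {1..k}"
    show "(fps_X * fps_deriv ?L) $ i * (1 + ?T) $ (k * d - i) = 0"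
    proof (cases "d dvd i")
      case True
      then obtain j where "i = j * d" by (metis dvdE mult.commute)
      with i d have "i = 0" by auto
      then show ?thesis by simp
    next
      case False
      then show ?thesis by (cases "i = 0") (simp_all add: mangoldt_of_log_identity[OF P] d_def)
    qed
  qed (use d in auto)
  also have "\<dots> = (\<Sum>j=1..k. (fps_X * fps_deriv ?L) $ (j * d) * (1 + ?T) $ (k * d - j * d))"
    using d by (subst sum.reindex) (auto simp: inj_on_def)
  also have "\<dots> = (\<Sum>j=1..k. mangoldt_of f (P ^ j) * f (P ^ (k - j)))"
  proof (rule sum.cong[OF refl])
    fix j assume j: "j \<in> {1..k}"
    have "(fps_X * fps_deriv ?L) $ (j * d) = mangoldt_of f (P ^ j)"
      using j d by (auto simp: mangoldt_of_log_identity[OF P] d_def)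
    \<comment> \<open>For \<open>j = k\<close> the value is the summand 1, which is
      \<open>f 1\<close>, since \<open>euler_tail\<close> has no constant term.\<close>
    moreover have "(1 + ?T) $ (k * d - j * d) = f (P ^ (k - j))"
      using j d f1 by (cases "j = k") (auto simp: euler_tail_def d_def simp flip: diff_mult_distrib)
    ultimately show "(fps_X * fps_deriv ?L) $ (j * d) * (1 + ?T) $ (k * d - j * d)
        = mangoldt_of f (P ^ j) * f (P ^ (k - j))" by simp
  qed
  finally show ?thesis by (simp add: d_def)
qed simp

section \<open>The recurrence for \<open>sigma\<close> and the bound for \<open>chi\<close>\<close>

lemma sigma_0: "f 1 = 1 \<Longrightarrow> sigma f 0 = 1"
  by (simp add: sigma_def monics_deg_0)

lemma sigma_recurrence:
  fixes f :: "'a::{field,finite} poly \<Rightarrow> complex"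
  assumes "multiplicative_on_monics f" and "f 1 = 1"
  shows "of_nat n * sigma f n = (\<Sum>k=1..n. chi f k * sigma f (n - k))"
proof -
  let ?q = "of_nat CARD('a) :: complex"
  have "of_nat n * sigma f n = of_nat n * (\<Sum>F\<in>monics_deg n. f F) / ?q ^ n"
    by (simp add: sigma_def)
  also have "\<dots> = (\<Sum>k=1..n. (\<Sum>G\<in>monics_deg k. mangoldt_of f G) * (\<Sum>D\<in>monics_deg (n - k). f D)) / ?q ^ n"
  proof (subst mangoldt_convolution[OF assms(1), of "mangoldt_of f"])
    show "mangoldt_of f F = 0" if "\<nexists>P. irreducible_power P F" for F
      using that by (simp add: mangoldt_of_def)
  qed (simp_all only: mangoldt_of_recurrence assms)
  also have "\<dots> = (\<Sum>k=1..n. chi f k * sigma f (n - k))"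
    unfolding sum_divide_distrib
    by (intro sum.cong refl) (auto simp: chi_def sigma_def simp flip: power_add)
  finally show ?thesis .
qed

text \<open>The class condition bounds each term by \<open>\<kappa>\<close> times the von Mangoldt
  function, whose total over degree \<open>n\<close> is exactly \<open>q ^ n\<close>.\<close>

lemma norm_chi_le:
  fixes f :: "'a::{field,finite} poly \<Rightarrow> complex"
  assumes "f \<in> class_C \<kappa>" and "n \<ge> 1"
  shows "norm (chi f n) \<le> \<kappa>"
proof -
  let ?q = "real CARD('a)"
  have "norm (\<Sum>F\<in>monics_deg n. mangoldt_of f F) \<le> (\<Sum>F\<in>monics_deg n. norm (mangoldt_of f F))"
    by (rule norm_sum)
  also have "\<dots> \<le> (\<Sum>F\<in>monics_deg n. \<kappa> * real (mangoldt_poly (F :: 'a poly)))"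
    using assms by (intro sum_mono) (auto simp: class_C_def monics_deg_def)
  also have "\<dots> = \<kappa> * real (\<Sum>F\<in>monics_deg n. mangoldt_poly (F :: 'a poly))"
    by (simp add: sum_distrib_left)
  also have "\<dots> = \<kappa> * ?q ^ n"
    by (simp only: sum_mangoldt_poly[OF assms(2)] of_nat_power)
  finally show ?thesis
    by (simp add: chi_def norm_divide norm_power field_simps)
qed

section \<open>Coefficient bounds by Parseval's identity\<close>

lemma has_integral_power_01: "((\<lambda>t::real. t ^ m) has_integral 1 / real (Suc m)) {0..1}"
proof -
  have "((\<lambda>t::real. t ^ m) has_integral 1 ^ Suc m / real (Suc m) - 0 ^ Suc m / real (Suc m)) {0..1}"
  proof (rule fundamental_theorem_of_calculus)
    show "((\<lambda>t. t ^ Suc m / real (Suc m)) has_vector_derivative t ^ m) (at t within {0..1})" for t :: real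
      using DERIV_cdivide[OF DERIV_pow[of "Suc m" t "{0..1}"], of "real (Suc m)"]
      by (simp add: has_real_derivative_iff_has_vector_derivative del: of_nat_Suc power_Suc)
  qed simp
  then show ?thesis by simp
qed

text \<open>Cauchy's formula for the \<open>n\<close>-th derivative at 0. The parametrization
  \<open>u\<close> of the circle has derivative \<open>2 * pi * \<i> * u\<close>, which cancels one
  of the \<open>Suc n\<close> powers of \<open>u\<close> in the denominator.\<close>

lemma has_integral_circle_fps_nth:
  fixes H :: "complex \<Rightarrow> complex"
  assumes hol: "H holomorphic_on UNIV" and exp: "H has_fps_expansion h" and "r > 0"
  shows "((\<lambda>x. H (of_real r * exp (2 * of_real pi * \<i> * of_real x))
            / (of_real r * exp (2 * of_real pi * \<i> * of_real x)) ^ n) has_integral h $ n) {0..1}"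
proof -
  let ?u = "\<lambda>x. of_real r * exp (2 * of_real pi * \<i> * of_real x) :: complex"
  have "((\<lambda>u. H u / (u - 0) ^ Suc n) has_contour_integral
      (2 * pi * \<i>) / fact n * (deriv ^^ n) H 0) (circlepath 0 r)"
    by (rule Cauchy_has_contour_integral_higher_derivative_circlepath)
       (use \<open>r > 0\<close> in \<open>auto intro: holomorphic_on_imp_continuous_on holomorphic_on_subset[OF hol]\<close>)
  then have "((\<lambda>x. H (circlepath 0 r x) / (circlepath 0 r x - 0) ^ Suc n
      * vector_derivative (circlepath 0 r) (at x within {0..1})) has_integral
      2 * of_real pi * \<i> / fact n * (deriv ^^ n) H 0) {0..1}"
    by (simp add: has_contour_integral_def)
  then have "((\<lambda>x. H (?u x) / ?u x ^ Suc n * (2 * of_real pi * \<i> * ?u x)) has_integral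
      2 * of_real pi * \<i> / fact n * (deriv ^^ n) H 0) {0..1}"
    by (rule has_integral_eq[rotated]) (simp add: vector_derivative_circlepath01, simp add: circlepath)
  then have "((\<lambda>x. 1 / (2 * of_real pi * \<i>) * (H (?u x) / ?u x ^ Suc n * (2 * of_real pi * \<i> * ?u x))) has_integral
      1 / (2 * of_real pi * \<i>) * (2 * of_real pi * \<i> / fact n * (deriv ^^ n) H 0)) {0..1}"
    by (rule has_integral_mult_right)
  also have "1 / (2 * of_real pi * \<i>) * (2 * of_real pi * \<i> / fact n * (deriv ^^ n) H 0) = h $ n"
    by (simp add: fps_nth_fps_expansion[OF exp])
  finally show ?thesis
    by (rule has_integral_eq[rotated]) (use \<open>r > 0\<close> in \<open>simp add: field_simps\<close>)
qed

lemma has_fps_expansion_power_sum: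
  fixes a :: "nat \<Rightarrow> complex"
  assumes "finite K"
  shows "(\<lambda>z. \<Sum>k\<in>K. a k * z ^ k) has_fps_expansion Abs_fps (\<lambda>k. if k \<in> K then a k else 0)"
proof -
  have "(\<lambda>z. \<Sum>k\<in>K. a k * z ^ k) has_fps_expansion (\<Sum>k\<in>K. fps_const (a k) * fps_X ^ k)"
    by (intro fps_expansion_intros)
  also have "(\<Sum>k\<in>K. fps_const (a k) * fps_X ^ k) = Abs_fps (\<lambda>k. if k \<in> K then a k else 0)"
    by (rule fps_ext) (use assms in \<open>simp add: fps_sum_nth fps_X_power_nth if_distrib cong: if_cong\<close>)
  finally show ?thesis .
qed

text \<open>On the circle \<open>cnj u ^ l = r ^ (2 * l) / u ^ l\<close>, so the squared modulus is
  a combination of the functions \<open>A(u) / u ^ l\<close>, and the integral of each of these is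
  the coefficient \<open>a l\<close>.\<close>

lemma Parseval_power_sum:
  fixes a :: "nat \<Rightarrow> complex"
  assumes "finite K" and "r > 0"
  shows "((\<lambda>x. (norm (\<Sum>k\<in>K. a k * (of_real r * exp (2 * of_real pi * \<i> * of_real x)) ^ k))\<^sup>2)
           has_integral (\<Sum>k\<in>K. (norm (a k))\<^sup>2 * r ^ (2 * k))) {0..1}"
proof -
  let ?u = "\<lambda>x. of_real r * exp (2 * of_real pi * \<i> * of_real x) :: complex"
  let ?A = "\<lambda>z. \<Sum>k\<in>K. a k * z ^ k"
  have "((\<lambda>x. \<Sum>l\<in>K. cnj (a l) * of_real (r ^ (2 * l)) * (?A (?u x) / ?u x ^ l)) has_integral
      (\<Sum>l\<in>K. cnj (a l) * of_real (r ^ (2 * l)) * (Abs_fps (\<lambda>k. if k \<in> K then a k else 0) $ l))) {0..1}"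
    by (intro has_integral_sum has_integral_mult_right has_integral_circle_fps_nth
        has_fps_expansion_power_sum holomorphic_intros assms)
  also have "(\<Sum>l\<in>K. cnj (a l) * of_real (r ^ (2 * l)) * (Abs_fps (\<lambda>k. if k \<in> K then a k else 0) $ l))
      = of_real (\<Sum>k\<in>K. (norm (a k))\<^sup>2 * r ^ (2 * k))"
    unfolding of_real_sum by (intro sum.cong refl) (simp add: complex_norm_square mult_ac del: of_real_power)
  also have "(\<lambda>x. \<Sum>l\<in>K. cnj (a l) * of_real (r ^ (2 * l)) * (?A (?u x) / ?u x ^ l))
      = (\<lambda>x. of_real ((norm (?A (?u x)))\<^sup>2))"
  proof
    fix x :: real
    have "norm (?u x) = r" using \<open>r > 0\<close> by (simp add: norm_mult)
    then have "?u x * cnj (?u x) = of_real (r ^ 2)"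
      using complex_norm_square[of "?u x"] by simp
    then have "cnj (?u x) ^ l = of_real (r ^ (2 * l)) / ?u x ^ l" for l
      using \<open>r > 0\<close> by (simp add: divide_simps power_mult flip: power_mult_distrib) (simp add: mult.commute)
    then show "(\<Sum>l\<in>K. cnj (a l) * of_real (r ^ (2 * l)) * (?A (?u x) / ?u x ^ l)) = of_real ((norm (?A (?u x)))\<^sup>2)"
      unfolding complex_norm_square cnj_sum sum_distrib_left by (intro sum.cong refl) simp
  qed
  finally show ?thesis by (drule_tac has_integral_Re) (simp only: Re_complex_of_real)
qed

text \<open>The coefficient is a Cauchy integral over the circle, in which \<open>M\<close> bounds
  \<open>G\<close>. A weighted AM-GM inequality followed by Parseval takes the place of
  Cauchy-Schwarz. \<open>\<alpha>\<close> and \<open>\<beta>\<close> bound the L2 norms and are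
  positive so that the weights can be formed.\<close>

lemma norm_fps_nth_mult_le:
  fixes a b :: "nat \<Rightarrow> complex" and G :: "complex \<Rightarrow> complex"
  assumes "finite K" and "r > 0" and hol: "G holomorphic_on UNIV" and exp: "G has_fps_expansion g"
    and M: "\<And>z. norm z = r \<Longrightarrow> norm (G z) \<le> M"
    and \<alpha>: "\<alpha> > 0" "(\<Sum>k\<in>K. (norm (a k))\<^sup>2 * r ^ (2 * k)) \<le> \<alpha>\<^sup>2"
    and \<beta>: "\<beta> > 0" "(\<Sum>k\<in>K. (norm (b k))\<^sup>2 * r ^ (2 * k)) \<le> \<beta>\<^sup>2"
  shows "norm ((Abs_fps (\<lambda>k. if k \<in> K then a k else 0) * (Abs_fps (\<lambda>k. if k \<in> K then b k else 0) * g)) $ n)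
    \<le> M * \<alpha> * \<beta> / r ^ n"
proof -
  let ?u = "\<lambda>x. of_real r * exp (2 * of_real pi * \<i> * of_real x) :: complex"
  define A where "A z = (\<Sum>k\<in>K. a k * z ^ k)" for z
  define B where "B z = (\<Sum>k\<in>K. b k * z ^ k)" for z
  let ?c = "(Abs_fps (\<lambda>k. if k \<in> K then a k else 0) * (Abs_fps (\<lambda>k. if k \<in> K then b k else 0) * g)) $ n"
  let ?SA = "\<Sum>k\<in>K. (norm (a k))\<^sup>2 * r ^ (2 * k)" and ?SB = "\<Sum>k\<in>K. (norm (b k))\<^sup>2 * r ^ (2 * k)"
  have u: "norm (?u x) = r" for x using \<open>r > 0\<close> by (simp add: norm_mult)
  have "M \<ge> 0" using M[OF u[of 0]] norm_ge_zero order_trans by blast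
  have int: "((\<lambda>x. A (?u x) * (B (?u x) * G (?u x)) / ?u x ^ n) has_integral ?c) {0..1}"
    unfolding A_def B_def
    by (intro has_integral_circle_fps_nth fps_expansion_intros has_fps_expansion_power_sum holomorphic_intros assms)
  have PA: "((\<lambda>x. (norm (A (?u x)))\<^sup>2) has_integral ?SA) {0..1}"
    and PB: "((\<lambda>x. (norm (B (?u x)))\<^sup>2) has_integral ?SB) {0..1}"
    unfolding A_def B_def by (intro Parseval_power_sum assms)+
  \<comment> \<open>The weights balance the two terms: once the sums are replaced by
    \<open>\<alpha>\<^sup>2\<close> and \<open>\<beta>\<^sup>2\<close>, each term gives
    \<open>\<alpha> * \<beta> / 2\<close>.\<close>
  let ?w = "\<lambda>x. M / r ^ n * (\<beta> / (2 * \<alpha>) * (norm (A (?u x)))\<^sup>2 + \<alpha> / (2 * \<beta>) * (norm (B (?u x)))\<^sup>2)"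
  have w: "(?w has_integral M / r ^ n * (\<beta> / (2 * \<alpha>) * ?SA + \<alpha> / (2 * \<beta>) * ?SB)) {0..1}"
    by (intro has_integral_mult_right has_integral_add PA PB)
  have "norm (A (?u x) * (B (?u x) * G (?u x)) / ?u x ^ n) \<le> ?w x" for x
  proof -
    have amgm: "p * q \<le> \<beta> / (2 * \<alpha>) * p\<^sup>2 + \<alpha> / (2 * \<beta>) * q\<^sup>2" for p q :: real
    proof -
      have "0 \<le> (\<beta> * p - \<alpha> * q)\<^sup>2 / (2 * \<alpha> * \<beta>)" using \<alpha>(1) \<beta>(1) by simp
      also have "\<dots> = \<beta> / (2 * \<alpha>) * p\<^sup>2 + \<alpha> / (2 * \<beta>) * q\<^sup>2 - p * q"
        using \<alpha>(1) \<beta>(1) by (simp add: field_simps power2_eq_square)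
      finally show ?thesis by simp
    qed
    have "norm (A (?u x) * (B (?u x) * G (?u x)) / ?u x ^ n)
        = norm (G (?u x)) / r ^ n * (norm (A (?u x)) * norm (B (?u x)))"
      using u[of x] by (simp add: norm_mult norm_divide norm_power)
    also have "\<dots> \<le> M / r ^ n * (norm (A (?u x)) * norm (B (?u x)))"
      using M[OF u] \<open>r > 0\<close> by (intro mult_right_mono divide_right_mono) auto
    also have "\<dots> \<le> ?w x"
      using \<open>M \<ge> 0\<close> \<open>r > 0\<close> by (intro mult_left_mono amgm) auto
    finally show ?thesis .
  qed
  then have "norm ?c \<le> M / r ^ n * (\<beta> / (2 * \<alpha>) * ?SA + \<alpha> / (2 * \<beta>) * ?SB)"
    using integral_norm_bound_integral[OF has_integral_integrable[OF int] has_integral_integrable[OF w]]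
    by (simp only: integral_unique[OF int] integral_unique[OF w])
  also have "\<dots> \<le> M / r ^ n * (\<beta> / (2 * \<alpha>) * \<alpha>\<^sup>2 + \<alpha> / (2 * \<beta>) * \<beta>\<^sup>2)"
    using \<alpha> \<beta> \<open>M \<ge> 0\<close> \<open>r > 0\<close> by (intro mult_left_mono add_mono) auto
  also have "\<dots> = M * \<alpha> * \<beta> / r ^ n"
    using \<alpha> \<beta> by (simp add: field_simps power2_eq_square)
  finally show ?thesis .
qed

section \<open>The truncated exponential and the main bound\<close>

lemma F_perp_scaled:
  fixes f :: "'a::{field,finite} poly \<Rightarrow> complex"
  shows "F_perp f n (z / of_nat CARD('a)) = exp (\<Sum>k=1..n-1. chi f k / of_nat k * z ^ k)"
  by (simp add: F_perp_def)

lemma F_perp_scaled_holomorphic: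
  fixes f :: "'a::{field,finite} poly \<Rightarrow> complex"
  shows "(\<lambda>z. F_perp f n (z / of_nat CARD('a))) holomorphic_on S"
  unfolding F_perp_scaled by (intro holomorphic_intros)

text \<open>Differentiating the exponential of a polynomial reproduces it times the derivative of
  the exponent, where the factor \<open>k\<close> cancels the \<open>1 / k\<close>. Uniqueness of
  expansions carries the identity from functions to series.\<close>

lemma F_perp_fps:
  fixes f :: "'a::{field,finite} poly \<Rightarrow> complex"
  obtains g where "(\<lambda>z. F_perp f n (z / of_nat CARD('a))) has_fps_expansion g" "g $ 0 = 1"
    "fps_X * fps_deriv g = Abs_fps (\<lambda>k. if k \<in> {1..n-1} then chi f k else 0) * g"
proof -
  let ?G = "\<lambda>z. F_perp f n (z / of_nat CARD('a))"
  have "?G has_fps_expansion fps_expansion ?G 0"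
    by (rule has_fps_expansion_fps_expansion[OF open_UNIV UNIV_I F_perp_scaled_holomorphic])
  then obtain g where g: "?G has_fps_expansion g" by blast
  have "?G 0 = g $ 0" using g by (rule has_fps_expansion_imp_0_eq_fps_nth_0)
  then have g0: "g $ 0 = 1"
    unfolding F_perp_scaled by (auto simp: power_0_left intro!: trans[OF _ exp_zero] sum.neutral arg_cong[of _ _ exp])
  have dG: "deriv ?G = (\<lambda>z. ?G z * (\<Sum>k=1..n-1. chi f k * z ^ (k - 1)))"
  proof
    fix z
    have "(?G has_field_derivative ?G z * (\<Sum>k=1..n-1. chi f k / of_nat k * (of_nat k * z ^ (k - 1)))) (at z)"
      unfolding F_perp_scaled by (auto intro!: derivative_eq_intros simp: mult.commute)
    also have "(\<Sum>k=1..n-1. chi f k / of_nat k * (of_nat k * z ^ (k - 1))) = (\<Sum>k=1..n-1. chi f k * z ^ (k - 1))"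
      by (intro sum.cong) auto
    finally show "deriv ?G z = ?G z * (\<Sum>k=1..n-1. chi f k * z ^ (k - 1))"
      by (rule DERIV_imp_deriv)
  qed
  have "(\<lambda>z. z * deriv ?G z) = (\<lambda>z. (\<Sum>k=1..n-1. chi f k * z ^ k) * ?G z)"
  proof
    fix z
    have "z * (\<Sum>k=1..n-1. chi f k * z ^ (k - 1)) = (\<Sum>k=1..n-1. chi f k * z ^ k)"
      unfolding sum_distrib_left
    proof (intro sum.cong refl)
      fix k assume "k \<in> {1..n-1}"
      then have "z ^ k = z * z ^ (k - 1)" by (cases k) auto
      then show "z * (chi f k * z ^ (k - 1)) = chi f k * z ^ k" by simp
    qed
    then show "z * deriv ?G z = (\<Sum>k=1..n-1. chi f k * z ^ k) * ?G z"
      unfolding dG by (simp only: mult.commute[of "?G z"] mult.assoc[symmetric])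
  qed
  moreover have "(\<lambda>z. z * deriv ?G z) has_fps_expansion fps_X * fps_deriv g"
    by (intro fps_expansion_intros g)
  moreover have "(\<lambda>z. (\<Sum>k=1..n-1. chi f k * z ^ k) * ?G z) has_fps_expansion
      Abs_fps (\<lambda>k. if k \<in> {1..n-1} then chi f k else 0) * g"
    by (intro fps_expansion_intros has_fps_expansion_power_sum g) auto
  ultimately have "fps_X * fps_deriv g = Abs_fps (\<lambda>k. if k \<in> {1..n-1} then chi f k else 0) * g"
    by (intro fps_expansion_unique_complex[of "\<lambda>z. z * deriv ?G z"]) (simp_all only:)
  with g g0 show ?thesis by (rule that)
qed

text \<open>For \<open>m < n\<close> the truncation at \<open>n - 1\<close> removes no
  \<open>chi f k\<close> with \<open>k \<le> m\<close>, so \<open>g\<close> follows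
  \<open>sigma_recurrence\<close> from the same initial value 1.\<close>

lemma F_perp_fps_nth_eq_sigma:
  fixes f :: "'a::{field,finite} poly \<Rightarrow> complex"
  assumes "multiplicative_on_monics f" and "f 1 = 1" and g0: "g $ 0 = 1"
    and g: "fps_X * fps_deriv g = Abs_fps (\<lambda>k. if k \<in> {1..n-1} then chi f k else 0) * g"
    and "m < n"
  shows "g $ m = sigma f m"
  using \<open>m < n\<close>
proof (induction m rule: less_induct)
  case (less m)
  show ?case
  proof (cases "m = 0")
    case False
    have "of_nat m * g $ m = (fps_X * fps_deriv g) $ m" using False by simp
    also have "\<dots> = (\<Sum>k=0..m. (if k \<in> {1..n-1} then chi f k else 0) * g $ (m - k))"
      unfolding g by (simp add: fps_mult_nth)
    also have "\<dots> = (\<Sum>k=1..m. chi f k * sigma f (m - k))"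
      by (rule sum.mono_neutral_cong_right) (use less in auto)
    also have "\<dots> = of_nat m * sigma f m"
      using assms by (simp add: sigma_recurrence)
    finally show ?thesis using False by simp
  qed (simp add: g0 sigma_0 assms)
qed

text \<open>The maximum over the smaller circle is attained at a point of the larger disc, where the
  maximum modulus principle applies.\<close>

lemma max_F_perp_mono:
  fixes f :: "'a::{field,finite} poly \<Rightarrow> complex"
  assumes "0 \<le> s" and "s \<le> t"
  shows "max_F_perp f n s \<le> max_F_perp f n t"
proof -
  obtain w where w: "norm w = sqrt s" "max_F_perp f n s = norm (F_perp f n (w / of_nat CARD('a)))"
    using max_F_perp_attained[OF \<open>0 \<le> s\<close>] by blast
  have t: "norm (F_perp f n (z / of_nat CARD('a))) \<le> max_F_perp f n t" if "norm z = sqrt t" for z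
    using max_F_perp_attained[of t f n] that assms by (metis order_trans)
  show ?thesis unfolding w(2)
  proof (rule maximum_modulus_frontier[where f = "\<lambda>z. F_perp f n (z / of_nat CARD('a))"])
    show "(\<lambda>z. F_perp f n (z / of_nat CARD('a))) holomorphic_on interior (cball 0 (sqrt t))"
      by (rule F_perp_scaled_holomorphic)
    show "continuous_on (closure (cball 0 (sqrt t))) (\<lambda>z. F_perp f n (z / of_nat CARD('a)))"
      by (intro holomorphic_on_imp_continuous_on F_perp_scaled_holomorphic)
    show "norm (F_perp f n (z / of_nat CARD('a))) \<le> max_F_perp f n t"
      if "z \<in> frontier (cball 0 (sqrt t))" for z
      using that by (intro t) (auto simp: frontier_cball)
    show "w \<in> cball 0 (sqrt t)" using w assms by simp
  qed auto
qed

lemma max_F_perp_nonneg: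
  assumes "0 \<le> t" shows "0 \<le> max_F_perp f n t"
  using max_F_perp_attained[OF assms, of f n] by (metis norm_ge_zero)

text \<open>A product of nonnegative nondecreasing functions is nondecreasing, hence integrable. The
  geometric sum stands in for the quotient, whose value at \<open>t = 1\<close> is 0 by the
  convention on division and could break monotonicity.\<close>

lemma max_F_perp_mult_integrable:
  "(\<lambda>t. max_F_perp f n t * (\<Sum>i<m. t ^ i)) integrable_on {0..1}"
  by (intro integrable_on_mono_on mono_onI mult_mono sum_mono power_mono)
     (auto intro!: max_F_perp_mono max_F_perp_nonneg sum_nonneg)

text \<open>
  The sum is the coefficient of \<open>z ^ n\<close> in \<open>A(z) B(z) F_perp(z / q)\<close>, where
  \<open>A(z) = \<Sum>k. \<chi>(k) t ^ (n - k - 1) z ^ k\<close> and \<open>B(z) = \<Sum>k. \<chi>(k) z ^ k\<close>: the product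
  of the last two factors is \<open>z\<close> times the derivative of the last one.
\<close>

lemma weighted_convolution_bound:
  fixes f :: "'a::{field,finite} poly \<Rightarrow> complex"
  assumes "\<kappa> > 0" and f: "f \<in> class_C \<kappa>" and "n \<ge> 2" and "t > 0"
  shows "norm (\<Sum>k=1..n-1. chi f k * of_real (t ^ (n - k - 1)) * (of_nat (n - k) * sigma f (n - k)))
    \<le> \<kappa>\<^sup>2 * (max_F_perp f n t * (\<Sum>i<n-1. t ^ i))"
proof -
  obtain g where exp: "(\<lambda>z. F_perp f n (z / of_nat CARD('a))) has_fps_expansion g" and g0: "g $ 0 = 1"
    and g: "fps_X * fps_deriv g = Abs_fps (\<lambda>k. if k \<in> {1..n-1} then chi f k else 0) * g"
    by (rule F_perp_fps)
  have f': "multiplicative_on_monics f" "f 1 = 1" using f by (auto simp: class_C_def)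
  \<comment> \<open>On the circle of this radius the Parseval weights \<open>r ^ (2 * k)\<close> are
    \<open>t ^ k\<close>.\<close>
  define r where "r = sqrt t"
  have r: "r > 0" "r\<^sup>2 = t" using \<open>t > 0\<close> by (auto simp: r_def)
  define S where "S = (\<Sum>i<n-1. t ^ i)"
  define a where "a k = chi f k * of_real (t ^ (n - k - 1))" for k
  have "S > 0" unfolding S_def using assms by (intro sum_pos) (auto simp: lessThan_empty_iff)
  have chi2: "(norm (chi f k))\<^sup>2 \<le> \<kappa>\<^sup>2" if "k \<ge> 1" for k
    using norm_chi_le[OF f that] by (intro power_mono) auto
  have SB: "(\<Sum>k=1..n-1. (norm (chi f k))\<^sup>2 * r ^ (2 * k)) \<le> (\<kappa> * sqrt (t * S))\<^sup>2"
  proof -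
    have "(\<Sum>k=1..n-1. (norm (chi f k))\<^sup>2 * r ^ (2 * k)) \<le> (\<Sum>k=1..n-1. \<kappa>\<^sup>2 * t ^ k)"
      using \<open>t > 0\<close> chi2 by (intro sum_mono mult_mono) (auto simp: power_mult r)
    also have "\<dots> = \<kappa>\<^sup>2 * (t * S)"
      unfolding S_def sum_distrib_left
      by (rule sum.reindex_bij_witness[where i = Suc and j = "\<lambda>k. k - 1"])
         (auto simp: power_Suc[symmetric] simp del: power_Suc)
    finally show ?thesis using \<open>t > 0\<close> \<open>S > 0\<close> by (simp add: power_mult_distrib)
  qed
  \<comment> \<open>The exponents satisfy
    \<open>2 * (n - k - 1) + k = (n - 1) + (n - 1 - k)\<close>, and the last part runs backwards
    through the geometric sum \<open>S\<close>.\<close>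
  have SA: "(\<Sum>k=1..n-1. (norm (a k))\<^sup>2 * r ^ (2 * k)) \<le> (\<kappa> * sqrt (t ^ (n - 1) * S))\<^sup>2"
  proof -
    have "(norm (a k))\<^sup>2 * r ^ (2 * k) \<le> \<kappa>\<^sup>2 * (t ^ (n - 1) * t ^ (n - 1 - k))" if k: "k \<in> {1..n-1}" for k
    proof -
      have "t ^ (2 * (n - k - 1)) * t ^ k = t ^ (n - 1) * t ^ (n - 1 - k)"
        using k by (auto simp flip: power_add intro!: arg_cong[of _ _ "power t"])
      moreover have "r ^ (2 * k) = t ^ k" by (simp add: power_mult r)
      ultimately have "(norm (a k))\<^sup>2 * r ^ (2 * k) = (norm (chi f k))\<^sup>2 * (t ^ (n - 1) * t ^ (n - 1 - k))"
        using \<open>t > 0\<close> by (simp add: a_def norm_mult power_mult_distrib norm_power mult_ac flip: power_mult)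
      also have "\<dots> \<le> \<kappa>\<^sup>2 * (t ^ (n - 1) * t ^ (n - 1 - k))"
        using k \<open>t > 0\<close> chi2 by (intro mult_right_mono) auto
      finally show ?thesis .
    qed
    then have "(\<Sum>k=1..n-1. (norm (a k))\<^sup>2 * r ^ (2 * k)) \<le> (\<Sum>k=1..n-1. \<kappa>\<^sup>2 * (t ^ (n - 1) * t ^ (n - 1 - k)))"
      by (intro sum_mono)
    also have "\<dots> = \<kappa>\<^sup>2 * (t ^ (n - 1) * S)"
      unfolding S_def sum_distrib_left
      by (rule sum.reindex_bij_witness[where i = "\<lambda>i. n - 1 - i" and j = "\<lambda>k. n - 1 - k"]) auto
    finally show ?thesis using \<open>t > 0\<close> \<open>S > 0\<close> by (simp add: power_mult_distrib)
  qed
  have "norm ((Abs_fps (\<lambda>k. if k \<in> {1..n-1} then a k else 0)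
        * (Abs_fps (\<lambda>k. if k \<in> {1..n-1} then chi f k else 0) * g)) $ n)
      \<le> max_F_perp f n t * (\<kappa> * sqrt (t ^ (n - 1) * S)) * (\<kappa> * sqrt (t * S)) / r ^ n"
  proof (rule norm_fps_nth_mult_le[OF _ r(1) F_perp_scaled_holomorphic exp _ _ SA _ SB])
    show "norm (F_perp f n (z / of_nat CARD('a))) \<le> max_F_perp f n t" if "norm z = r" for z
      using max_F_perp_attained[of t f n] that \<open>t > 0\<close> unfolding r_def by (metis less_imp_le)
  qed (use \<open>\<kappa> > 0\<close> \<open>S > 0\<close> \<open>t > 0\<close> in auto)
  \<comment> \<open>Both roots contain the same \<open>S\<close>, and their powers of
    \<open>t\<close> combine to \<open>t ^ n\<close>, whose root \<open>r ^ n\<close> cancels the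
    denominator.\<close>
  also have "\<dots> = \<kappa>\<^sup>2 * (max_F_perp f n t * S)"
  proof -
    have "sqrt (t ^ (n - 1) * S) * sqrt (t * S) = sqrt ((t ^ (n - 1) * t) * S\<^sup>2)"
      by (simp add: power2_eq_square mult_ac flip: real_sqrt_mult)
    also have "t ^ (n - 1) * t = t ^ n" using \<open>n \<ge> 2\<close> by (cases n) auto
    also have "sqrt (t ^ n * S\<^sup>2) = r ^ n * S"
      using \<open>S > 0\<close> by (simp add: real_sqrt_mult real_sqrt_power r_def)
    finally have *: "sqrt (t ^ (n - 1) * S) * sqrt (t * S) = r ^ n * S" .
    have "max_F_perp f n t * (\<kappa> * sqrt (t ^ (n - 1) * S)) * (\<kappa> * sqrt (t * S)) / r ^ n
        = \<kappa>\<^sup>2 * max_F_perp f n t * (sqrt (t ^ (n - 1) * S) * sqrt (t * S)) / r ^ n"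
      by (simp add: power2_eq_square mult_ac)
    also have "\<dots> = \<kappa>\<^sup>2 * (max_F_perp f n t * S)"
      unfolding * using r by simp
    finally show ?thesis .
  qed
  \<comment> \<open>For \<open>1 \<le> k < n\<close> the index \<open>n - k\<close> lies below
    \<open>n\<close>, where \<open>g\<close> agrees with \<open>sigma f\<close>; this makes the
    coefficient of \<open>fps_X * fps_deriv g\<close> equal to
    \<open>(n - k) * sigma f (n - k)\<close>.\<close>
  also have "(Abs_fps (\<lambda>k. if k \<in> {1..n-1} then a k else 0)
        * (Abs_fps (\<lambda>k. if k \<in> {1..n-1} then chi f k else 0) * g)) $ n
      = (\<Sum>k=0..n. (if k \<in> {1..n-1} then a k else 0) * (fps_X * fps_deriv g) $ (n - k))"
    by (simp only: fps_mult_nth[of "Abs_fps h" for h] g[symmetric] fps_nth_Abs_fps)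
  also have "\<dots> = (\<Sum>k=1..n-1. a k * (of_nat (n - k) * sigma f (n - k)))"
  proof (rule sum.mono_neutral_cong_right)
    show "(if k \<in> {1..n-1} then a k else 0) * (fps_X * fps_deriv g) $ (n - k)
        = a k * (of_nat (n - k) * sigma f (n - k))" if k: "k \<in> {1..n-1}" for k
    proof -
      have "g $ (n - k) = sigma f (n - k)"
        using k by (intro F_perp_fps_nth_eq_sigma[OF f' g0 g]) auto
      then show ?thesis using k by (auto simp: Suc_diff_Suc)
    qed
  qed auto
  finally show ?thesis by (simp add: a_def S_def)
qed

text \<open>The weight \<open>(n - k) * t ^ (n - k - 1)\<close> has integral 1, so the sum bounded
  in \<open>weighted_convolution_bound\<close> integrates to
  \<open>n * sigma_perp f n\<close>.\<close>

lemma sigma_perp_bound: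
  fixes f :: "'a::{field,finite} poly \<Rightarrow> complex"
  assumes "\<kappa> > 0" and f: "f \<in> class_C \<kappa>" and "n \<ge> 1"
  shows "norm (sigma_perp f n)
           \<le> \<kappa>\<^sup>2 / real n * integral {0..1} (\<lambda>t. max_F_perp f n t * ((1 - t ^ (n - 1)) / (1 - t)))"
proof -
  have f': "multiplicative_on_monics f" "f 1 = 1" using f by (auto simp: class_C_def)
  define D where "D t = (\<Sum>k=1..n-1. chi f k * of_real (t ^ (n - k - 1)) * (of_nat (n - k) * sigma f (n - k)))"
    for t :: real
  let ?W = "\<lambda>t. max_F_perp f n t * (\<Sum>i<n-1. t ^ i)"
  \<comment> \<open>The term \<open>k = n\<close> of the recurrence is
    \<open>chi f n * sigma f 0 = chi f n\<close>, exactly what \<open>sigma_perp\<close> removes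
    after multiplication by \<open>n\<close>.\<close>
  have perp: "of_nat n * sigma_perp f n = (\<Sum>k=1..n-1. chi f k * sigma f (n - k))"
  proof -
    obtain m where "n = Suc m" using \<open>n \<ge> 1\<close> by (cases n) auto
    with sigma_recurrence[OF f', of n] show ?thesis
      by (simp add: sigma_perp_def sigma_0 f' field_simps del: of_nat_Suc)
  qed
  have int: "(D has_integral of_nat n * sigma_perp f n) {0..1}"
    unfolding perp D_def
  proof (intro has_integral_sum)
    fix k assume "k \<in> {1..n-1}"
    then have "k < n" by auto
    have "((\<lambda>t. of_real (t ^ (n - k - 1)) :: complex) has_integral 1 / of_nat (n - k)) {0..1}"
    proof -
      have "((\<lambda>t::real. t ^ (n - k - 1)) has_integral 1 / real (n - k)) {0..1}"
      proof -
        have "Suc (n - k - 1) = n - k" using \<open>k < n\<close> by auto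
        then show ?thesis using has_integral_power_01[of "n - k - 1"] by (simp only:)
      qed
      then show ?thesis by (auto dest!: has_integral_of_real[where 'b = complex] simp del: of_nat_diff)
    qed
    then have "((\<lambda>t. chi f k * (of_nat (n - k) * sigma f (n - k)) * of_real (t ^ (n - k - 1))) has_integral
        chi f k * (of_nat (n - k) * sigma f (n - k)) * (1 / of_nat (n - k))) {0..1}"
      by (rule has_integral_mult_right)
    then show "((\<lambda>t. chi f k * of_real (t ^ (n - k - 1)) * (of_nat (n - k) * sigma f (n - k))) has_integral
        chi f k * sigma f (n - k)) {0..1}"
      using \<open>k < n\<close> by (simp add: mult_ac)
  qed simp
  have bound: "norm (D t) \<le> \<kappa>\<^sup>2 * ?W t" if "t > 0" for t
  proof (cases "n = 1")
    case False
    with assms that show ?thesis unfolding D_def by (intro weighted_convolution_bound) auto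
  qed (simp add: D_def)
  have W: "(\<lambda>t. \<kappa>\<^sup>2 * ?W t) integrable_on {0..1}"
    by (intro integrable_on_mult_right max_F_perp_mult_integrable)
  \<comment> \<open>The bound is available for \<open>t > 0\<close> only, where the circle has
    positive radius, so the majorant is altered at the single point 0.\<close>
  let ?V = "\<lambda>t. if t = 0 then norm (D 0) else \<kappa>\<^sup>2 * ?W t"
  have V: "?V integrable_on {0..1}"
    by (rule integrable_spike_finite[OF _ _ W, of "{0}"]) auto
  have "real n * norm (sigma_perp f n) = norm (integral {0..1} D)"
    by (simp add: integral_unique[OF int] norm_mult)
  also have "\<dots> \<le> integral {0..1} ?V"
    using int V bound by (intro integral_norm_bound_integral has_integral_integrable) auto
  also have "\<dots> = integral {0..1} (\<lambda>t. \<kappa>\<^sup>2 * ?W t)"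
    by (rule integral_spike[of "{0}"]) auto
  also have "\<dots> = \<kappa>\<^sup>2 * integral {0..1} ?W"
    by simp
  \<comment> \<open>The quotient can differ from the geometric sum only at \<open>t = 1\<close>,
    where division by zero makes it 0.\<close>
  also have "integral {0..1} ?W = integral {0..1} (\<lambda>t. max_F_perp f n t * ((1 - t ^ (n - 1)) / (1 - t)))"
    by (rule integral_spike[of "{1}"]) (auto simp: sum_gp_strict)
  finally show ?thesis using \<open>n \<ge> 1\<close> by (simp add: field_simps)
qed

theorem theorem1:
  fixes f :: "'a::{field,finite} poly \<Rightarrow> complex" and \<kappa> :: real and n :: nat
  assumes "\<kappa> > 0" and "f \<in> class_C \<kappa>" and "n \<ge> 1"
  shows "norm (sigma_perp f n)
           \<le> \<kappa>\<^sup>2 / real n * integral {0..1} (\<lambda>t. max_F_perp f n t * ((1 - t ^ (n - 1)) / (1 - t)))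
         \<and> norm (sigma f n) \<le> norm (sigma_perp f n) + norm (chi f n / of_nat n)
         \<and> norm (sigma_perp f n) + norm (chi f n / of_nat n)
           \<le> \<kappa>\<^sup>2 / real n * integral {0..1} (\<lambda>t. max_F_perp f n t * ((1 - t ^ (n - 1)) / (1 - t)))
             + \<kappa> / real n"
proof (intro conjI add_mono sigma_perp_bound assms)
  show "norm (sigma f n) \<le> norm (sigma_perp f n) + norm (chi f n / of_nat n)"
    using norm_triangle_ineq[of "sigma_perp f n" "chi f n / of_nat n"] by (simp add: sigma_perp_def)
  show "norm (chi f n / of_nat n) \<le> \<kappa> / real n"
    using norm_chi_le[OF assms(2,3)] by (simp add: norm_divide divide_right_mono)
qed

end
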